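(* Let $\boldsymbol{a}=(a_1,\ldots,a_n)\in\mathbb{Z}^n$ be the weight vector of a linear action of $\mathbb{C}^\times$ on $\mathbb{C}^n$. Assume that there is an integer $k$ with $0<k<n$ such that $a_i<0$ for $i\leq k$ and $a_i>0$ for $i>k$. Then, for $0<|t|<1$, $$ \operatorname{Hilb}_{\boldsymbol{a}}(t)=\lim_{\boldsymbol{c}\to\boldsymbol{a}}\ \sum_{i=1}^k\ \sum_{\zeta^{-a_i}=1}\ \frac{1}{-c_i\prod\limits_{\substack{j=1\\ j\neq i}}^n\left(1-\zeta^{a_j}\,t^{(c_i-c_j)/c_i}\right)}, $$ where $\boldsymbol{c}=(c_1,\ldots,c_n)$ tends to $\boldsymbol{a}$ in $\mathbb{R}^n$ through points with $c_i\neq c_j$ whenever $i\neq j$ and $i,j\leq k$ (in particular, the limit exists).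
   Context: The action with weight vector $\boldsymbol{a}$ is $w\cdot(z_1,\ldots,z_n)=(w^{a_1}z_1,\ldots,w^{a_n}z_n)$ for $w\in\mathbb{C}^\times$. $\operatorname{Hilb}_{\boldsymbol{a}}(t)=\sum_{m\geq 0}\dim_{\mathbb{C}}(R_m)\,t^m$ is the Hilbert series of the algebra $R=\mathbb{C}[z_1,\ldots,z_n]^{\mathbb{C}^\times_{\boldsymbol{a}}}$ of invariant polynomials, graded by the usual polynomial degree. The inner sum runs over all complex $\zeta$ with $\zeta^{-a_i}=1$, i.e. the $|a_i|$-th roots of unity. For a fixed $t$ with $0<|t|<1$, real powers of $t$ are defined as $t^r=\exp(r\log t)$ for one fixed choice of $\log t$. *)

theory Defs
  imports "HOL-Analysis.Analysis" "HOL-Library.Poly_Mapping"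
begin

text \<open>
  The variables \<open>z\<^sub>1, \<dots>, z\<^sub>n\<close>, and all other vectors with \<open>n\<close> entries, are indexed by \<open>0, \<dots>, n - 1\<close>.
  A polynomial is a finitely supported map from exponent vectors to coefficients.
\<close>

type_synonym cpoly = "(nat \<Rightarrow>\<^sub>0 nat) \<Rightarrow>\<^sub>0 complex"

definition cpolys :: "nat \<Rightarrow> cpoly set" where
  "cpolys n = {p. \<forall>e\<in>Poly_Mapping.keys p. Poly_Mapping.keys e \<subseteq> {..<n}}"

definition eval_cpoly :: "cpoly \<Rightarrow> (nat \<Rightarrow> complex) \<Rightarrow> complex" where
  "eval_cpoly p z = (\<Sum>e\<in>Poly_Mapping.keys p.
     Poly_Mapping.lookup p e * (\<Prod>i\<in>Poly_Mapping.keys e. z i ^ Poly_Mapping.lookup e i))"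

definition scale_cpoly :: "complex \<Rightarrow> cpoly \<Rightarrow> cpoly" where
  "scale_cpoly c p = Poly_Mapping.map ((*) c) p"

lemma vector_space_scale_cpoly: "vector_space scale_cpoly"
  by unfold_locales
     (simp_all add: scale_cpoly_def mult_map_scale_conv_mult distrib_left distrib_right single_add
        mult_single flip: mult.assoc)

text \<open>The zero polynomial has no monomials and so is homogeneous of every degree.\<close>

definition homogeneous_cpoly :: "nat \<Rightarrow> cpoly \<Rightarrow> bool" where
  "homogeneous_cpoly m p \<longleftrightarrow>
     (\<forall>e\<in>Poly_Mapping.keys p. (\<Sum>i\<in>Poly_Mapping.keys e. Poly_Mapping.lookup e i) = m)"

definition weight_action :: "(nat \<Rightarrow> int) \<Rightarrow> complex \<Rightarrow> (nat \<Rightarrow> complex) \<Rightarrow> nat \<Rightarrow> complex" where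
  "weight_action a w z = (\<lambda>i. w powi a i * z i)"

definition invariant_cpolys :: "nat \<Rightarrow> (nat \<Rightarrow> int) \<Rightarrow> cpoly set" where
  "invariant_cpolys n a =
     {p \<in> cpolys n. \<forall>w z. w \<noteq> 0 \<longrightarrow> eval_cpoly p (weight_action a w z) = eval_cpoly p z}"

definition hilbert_series :: "nat \<Rightarrow> (nat \<Rightarrow> int) \<Rightarrow> complex fps" where
  "hilbert_series n a = Abs_fps (\<lambda>m. of_nat
     (vector_space.dim scale_cpoly {p \<in> invariant_cpolys n a. homogeneous_cpoly m p}))"

text \<open>
  A power \<open>t\<^sup>r\<close> with \<open>r\<close> real is \<open>exp (r * L)\<close>, where \<open>L\<close> is the chosen logarithm of \<open>t\<close>.
\<close>

definition perturbed_residue_sum ::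
  "nat \<Rightarrow> nat \<Rightarrow> (nat \<Rightarrow> int) \<Rightarrow> complex \<Rightarrow> (nat \<Rightarrow> real) \<Rightarrow> complex" where
  "perturbed_residue_sum n k a L c =
     (\<Sum>i<k. \<Sum>\<zeta> | \<zeta> powi (- a i) = 1.
        1 / (- of_real (c i) *
          (\<Prod>j\<in>{..<n} - {i}. 1 - \<zeta> powi a j * exp (of_real ((c i - c j) / c i) * L))))"

text \<open>
  Points of \<open>Euclidean_space n\<close> vanish from index \<open>n\<close> on.
\<close>

definition real_vec :: "nat \<Rightarrow> (nat \<Rightarrow> int) \<Rightarrow> nat \<Rightarrow> real" where
  "real_vec n a = (\<lambda>i. if i < n then of_int (a i) else 0)"

definition generic_near :: "nat \<Rightarrow> nat \<Rightarrow> (nat \<Rightarrow> int) \<Rightarrow> (nat \<Rightarrow> real) filter" where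
  "generic_near n k a = atin_within (Euclidean_space n) (real_vec n a)
     {c. \<forall>i<k. \<forall>j<k. i \<noteq> j \<longrightarrow> c i \<noteq> c j}"

text \<open>The filter is proper, so a limit along it is unique.\<close>

lemma generic_near_neq_bot:
  assumes "0 < k" "k < n"
  shows "generic_near n k a \<noteq> bot"
proof
  assume bot: "generic_near n k a = bot"
  define S :: "(nat \<Rightarrow> real) set" where "S = {c. \<forall>i<k. \<forall>j<k. i \<noteq> j \<longrightarrow> c i \<noteq> c j}"
  define c where "c = (\<lambda>(e::real) i. if i < n then of_int (a i) + e * real i else 0)"
  have c0: "c 0 = real_vec n a"
    by (auto simp: c_def real_vec_def)
  have cont: "continuous_map euclideanreal (Euclidean_space n) c"
    unfolding Euclidean_space_def
    by (auto simp: continuous_map_in_subtopology continuous_map_componentwise_UNIV c_def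
             intro!: continuous_intros)
  have top: "real_vec n a \<in> topspace (Euclidean_space n)"
    by (auto simp: topspace_Euclidean_space real_vec_def)
  have "eventually (\<lambda>_. False) (generic_near n k a)"
    using bot by simp
  then obtain T where T: "openin (Euclidean_space n) T" "real_vec n a \<in> T"
      "\<And>x. x \<in> T \<Longrightarrow> x \<in> S \<Longrightarrow> x = real_vec n a"
    using top unfolding generic_near_def S_def[symmetric] eventually_atin_within by blast
  have "open {e. c e \<in> T}"
    using openin_continuous_map_preimage[OF cont T(1)] by simp
  moreover have "0 \<in> {e. c e \<in> T}"
    using T(2) c0 by simp
  ultimately obtain d where d: "d > 0" "\<And>e. \<bar>e\<bar> < d \<Longrightarrow> c e \<in> T"
    by (auto simp: open_real)
  define e where "e = min (d / 2) (1 / (2 * real n))"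
  have e: "e > 0" "\<bar>e\<bar> < d" "e * real n < 1"
    using d(1) assms unfolding e_def by (auto simp: min_def field_simps)
  have "c e i \<noteq> c e j" if "i < k" "j < i" for i j
  proof
    assume "c e i = c e j"
    then have eq: "of_int (a j - a i) = e * real (i - j)"
      using that assms by (simp add: c_def of_nat_diff algebra_simps)
    have "e * real (i - j) \<le> e * real n"
      using that assms e(1) by (intro mult_left_mono) auto
    moreover have "e * real (i - j) > 0"
      using e(1) that by simp
    ultimately have "(0::real) < of_int (a j - a i)" "of_int (a j - a i) < (1::real)"
      using eq e(3) by linarith+
    then show False by simp
  qed
  then have "c e \<in> S"
    unfolding S_def by (smt (verit, best) linorder_neqE_nat mem_Collect_eq)
  then have "c e = real_vec n a"
    using T(3) d(2) e(2) by blast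
  then have "c e 1 = real_vec n a 1" by simp
  then show False
    using assms e(1) by (auto simp: c_def real_vec_def)
qed

end

theory Submission
  imports Defs "HOL-Complex_Analysis.Complex_Analysis"
begin

text \<open>
  Termwise integration gives the Molien-Weyl formula: the Hilbert series at \<open>t\<close> is
  \<open>1 / (2 \<pi> \<i>)\<close> times the integral of \<open>1 / (z \<Prod>\<^sub>j (1 - t z^a\<^sub>j))\<close> over the unit circle, hence the sum of
  the residues at the points \<open>z\<^sub>0 = \<zeta> exp (- L / v)\<close> with \<open>v\<close> a negative weight and \<open>\<zeta>^v = 1\<close>.
  Near such a \<open>z\<^sub>0\<close> write \<open>z = \<zeta> exp (u z)\<close> with \<open>u\<close> a branch of the logarithm and perturb only the
  exponent of \<open>exp (u z)\<close>, not that of \<open>\<zeta>\<close>: the function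
  \<open>1 / (z \<Prod>\<^sub>j (1 - \<zeta>^a\<^sub>j t exp (c\<^sub>j u z)))\<close> has for generic \<open>c\<close> near \<open>a\<close> one simple pole near \<open>z\<^sub>0\<close> for
  each \<open>i\<close> with \<open>a\<^sub>i = v\<close>, namely where \<open>u z = - L / c\<^sub>i\<close>, and its residue there is exactly the summand
  of index \<open>(i, \<zeta>)\<close>. The integral over a small circle around \<open>z\<^sub>0\<close> is continuous in \<open>c\<close>, so these
  summands add up in the limit to the residue at \<open>z\<^sub>0\<close>.
\<close>

section \<open>Invariant monomials\<close>

definition monomial_fun :: "(nat \<Rightarrow>\<^sub>0 nat) \<Rightarrow> (nat \<Rightarrow> complex) \<Rightarrow> complex" where
  "monomial_fun e z = (\<Prod>i\<in>Poly_Mapping.keys e. z i ^ Poly_Mapping.lookup e i)"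

definition weight :: "(nat \<Rightarrow> int) \<Rightarrow> (nat \<Rightarrow>\<^sub>0 nat) \<Rightarrow> int" where
  "weight a e = (\<Sum>i\<in>Poly_Mapping.keys e. a i * int (Poly_Mapping.lookup e i))"

definition total_degree :: "(nat \<Rightarrow>\<^sub>0 nat) \<Rightarrow> nat" where
  "total_degree e = (\<Sum>i\<in>Poly_Mapping.keys e. Poly_Mapping.lookup e i)"

definition invariant_exponents :: "nat \<Rightarrow> (nat \<Rightarrow> int) \<Rightarrow> nat \<Rightarrow> (nat \<Rightarrow>\<^sub>0 nat) set" where
  "invariant_exponents n a m =
     {e. Poly_Mapping.keys e \<subseteq> {..<n} \<and> weight a e = 0 \<and> total_degree e = m}"

text \<open>Monomials are characters of the monoid of vectors under the entrywise product, which is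
  the setting of Dedekind's argument.\<close>

lemma monomial_fun_mult:
  "monomial_fun e (\<lambda>i. y i * z i) = monomial_fun e y * monomial_fun e z"
  by (simp add: monomial_fun_def power_mult_distrib prod.distrib)

text \<open>Setting one variable to 2 and all others to 1 isolates a single exponent.\<close>

lemma monomial_fun_eq_iff: "monomial_fun e = monomial_fun e' \<longleftrightarrow> e = e'"
proof
  assume eq: "monomial_fun e = monomial_fun e'"
  have "Poly_Mapping.lookup e i = Poly_Mapping.lookup e' i" for i
  proof -
    define z :: "nat \<Rightarrow> complex" where "z = (\<lambda>j. if j = i then 2 else 1)"
    have "monomial_fun f z = 2 ^ Poly_Mapping.lookup f i" for f
    proof -
      have "monomial_fun f z
        = (\<Prod>j\<in>Poly_Mapping.keys f. if j = i then 2 ^ Poly_Mapping.lookup f i else 1)"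
        unfolding monomial_fun_def z_def by (intro prod.cong) auto
      also have "\<dots> = 2 ^ Poly_Mapping.lookup f i"
        by (simp add: prod.delta' prod.delta in_keys_iff)
      finally show ?thesis .
    qed
    then have "(2::complex) ^ Poly_Mapping.lookup e i = 2 ^ Poly_Mapping.lookup e' i"
      using eq by metis
    \<comment> \<open>Norms move the equation to the reals, where a power of 2 determines its
      exponent.\<close>
    then have "(2::real) ^ Poly_Mapping.lookup e i = 2 ^ Poly_Mapping.lookup e' i"
      by (metis norm_numeral norm_power)
    then show ?thesis by simp
  qed
  then show "e = e'" by (simp add: poly_mapping_eq_iff fun_eq_iff)
qed simp

text \<open>Dedekind's argument for the linear independence of characters.\<close>

lemma monomial_fun_independent:
  assumes "finite S" "\<And>z. (\<Sum>e\<in>S. c e * monomial_fun e z) = 0" "e \<in> S"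
  shows "c e = 0"
  using assms
proof (induction S arbitrary: c e rule: finite_induct)
  case empty
  then show ?case by simp
next
  case (insert e0 S)
  have zero: "c e = 0" if "e \<in> S" for e
  proof -
    have "e \<noteq> e0" using that insert.hyps by auto
    then obtain y where y: "monomial_fun e y \<noteq> monomial_fun e0 y"
      using monomial_fun_eq_iff by blast
    \<comment> \<open>The relation at the product of \<open>y\<close> and \<open>z\<close>, minus
      \<open>monomial_fun e0 y\<close> times the relation at \<open>z\<close>, loses its
      \<open>e0\<close> term. Since \<open>y\<close> separates \<open>e\<close> from
      \<open>e0\<close>, the new coefficient of \<open>e\<close> vanishes only with
      \<open>c e\<close>.\<close>
    have "(\<Sum>e\<in>S. c e * (monomial_fun e y - monomial_fun e0 y) * monomial_fun e z) = 0" for z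
    proof -
      have "0 = (\<Sum>e\<in>insert e0 S. c e * monomial_fun e (\<lambda>i. y i * z i))
            - monomial_fun e0 y * (\<Sum>e\<in>insert e0 S. c e * monomial_fun e z)"
        using insert.prems(1) by simp
      also have "\<dots> = (\<Sum>e\<in>S. c e * (monomial_fun e y - monomial_fun e0 y) * monomial_fun e z)"
        using insert.hyps
        by (simp add: monomial_fun_mult sum_distrib_left sum_subtractf algebra_simps)
      finally show ?thesis by simp
    qed
    from insert.IH[OF this that] y show "c e = 0" by simp
  qed
  have "c e0 * monomial_fun e0 (\<lambda>_. 1) = 0"
    using insert.prems(1)[of "\<lambda>_. 1"] insert.hyps zero by simp
  then have "c e0 = 0" by (simp add: monomial_fun_def)
  with zero insert.prems(2) show ?case by auto
qed

section \<open>Invariance as a condition on weights\<close>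

lemma monomial_fun_weight_action:
  assumes "w \<noteq> 0"
  shows "monomial_fun e (weight_action a w z) = w powi weight a e * monomial_fun e z"
proof -
  have "w powi (\<Sum>i\<in>A. a i * int (Poly_Mapping.lookup e i))
      = (\<Prod>i\<in>A. (w powi a i) ^ Poly_Mapping.lookup e i)" if "finite A" for A
    using that assms
    by (induction A rule: finite_induct) (simp_all add: power_int_add power_int_mult)
  then show ?thesis
    by (simp add: monomial_fun_def weight_action_def weight_def power_mult_distrib prod.distrib)
qed

lemma eval_cpoly_monomial_fun:
  "eval_cpoly p z = (\<Sum>e\<in>Poly_Mapping.keys p. Poly_Mapping.lookup p e * monomial_fun e z)"
  by (simp add: eval_cpoly_def monomial_fun_def)

text \<open>The single group element 2 detects invariance: comparing \<open>p\<close> with its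
  translate gives a linear relation among distinct monomials, and \<open>2 powi m = 1\<close> forces
  \<open>m = 0\<close>.\<close>

lemma invariant_cpolys_iff:
  "p \<in> invariant_cpolys n a \<longleftrightarrow>
     (\<forall>e\<in>Poly_Mapping.keys p. Poly_Mapping.keys e \<subseteq> {..<n} \<and> weight a e = 0)"
proof
  assume p: "p \<in> invariant_cpolys n a"
  have "weight a e = 0" if e: "e \<in> Poly_Mapping.keys p" for e
  proof -
    have "(\<Sum>e\<in>Poly_Mapping.keys p.
        Poly_Mapping.lookup p e * (2 powi weight a e - 1) * monomial_fun e z) = 0" for z
    proof -
      have "eval_cpoly p (weight_action a 2 z) = eval_cpoly p z"
        using p by (simp add: invariant_cpolys_def)
      then show ?thesis
        by (simp add: eval_cpoly_monomial_fun monomial_fun_weight_action algebra_simps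
            sum_subtractf)
    qed
    from monomial_fun_independent[OF _ this e] e
    have "(2::complex) powi weight a e = 1" by (simp add: in_keys_iff)
    then have "(2::real) powi weight a e = 2 powi 0"
      by (metis norm_numeral norm_one norm_power_int power_int_0_right)
    then show ?thesis
      using power_int_strict_increasing[of "weight a e" 0 "2::real"]
        power_int_strict_increasing[of 0 "weight a e" "2::real"]
      by (cases "weight a e" "0::int" rule: linorder_cases) auto
  qed
  then show "\<forall>e\<in>Poly_Mapping.keys p. Poly_Mapping.keys e \<subseteq> {..<n} \<and> weight a e = 0"
    using p by (auto simp: invariant_cpolys_def cpolys_def)
next
  assume "\<forall>e\<in>Poly_Mapping.keys p. Poly_Mapping.keys e \<subseteq> {..<n} \<and> weight a e = 0"
  then show "p \<in> invariant_cpolys n a"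
    by (auto simp: invariant_cpolys_def cpolys_def eval_cpoly_monomial_fun
        monomial_fun_weight_action intro!: sum.cong)
qed

text \<open>Carries sums over exponent vectors to sums over a product of index sets, where they
  factor into one-variable series. Restricting to \<open>{..<n}\<close> yields the extensional
  functions of which \<open>PiE\<close> consists.\<close>

lemma bij_betw_exponents:
  "bij_betw (\<lambda>e. \<lambda>i\<in>{..<n}. Poly_Mapping.lookup e i)
     {e :: nat \<Rightarrow>\<^sub>0 nat. Poly_Mapping.keys e \<subseteq> {..<n}} (PiE {..<n} (\<lambda>_. UNIV))"
proof (rule bij_betwI')
  fix e e' :: "nat \<Rightarrow>\<^sub>0 nat"
  assume "e \<in> {e. Poly_Mapping.keys e \<subseteq> {..<n}}" "e' \<in> {e. Poly_Mapping.keys e \<subseteq> {..<n}}"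
  then have out: "Poly_Mapping.lookup e i = 0" "Poly_Mapping.lookup e' i = 0" if "\<not> i < n" for i
    using that by (auto simp: in_keys_iff)
  show "((\<lambda>i\<in>{..<n}. Poly_Mapping.lookup e i) = (\<lambda>i\<in>{..<n}. Poly_Mapping.lookup e' i))
      \<longleftrightarrow> e = e'"
  proof
    assume eq: "(\<lambda>i\<in>{..<n}. Poly_Mapping.lookup e i) = (\<lambda>i\<in>{..<n}. Poly_Mapping.lookup e' i)"
    have "Poly_Mapping.lookup e i = Poly_Mapping.lookup e' i" for i
      using out[of i] fun_cong[OF eq, of i] by (cases "i < n") auto
    then show "e = e'" by (rule poly_mapping_eqI)
  qed simp
next
  fix g :: "nat \<Rightarrow> nat" assume g: "g \<in> PiE {..<n} (\<lambda>_. UNIV)"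
  define e where "e = Abs_poly_mapping (\<lambda>i. if i < n then g i else 0)"
  have "finite {i. (if i < n then g i else 0) \<noteq> 0}"
    by (rule finite_subset[of _ "{..<n}"]) auto
  then have e: "Poly_Mapping.lookup e = (\<lambda>i. if i < n then g i else 0)"
    unfolding e_def by (rule lookup_Abs_poly_mapping)
  show "\<exists>e\<in>{e. Poly_Mapping.keys e \<subseteq> {..<n}}. g = (\<lambda>i\<in>{..<n}. Poly_Mapping.lookup e i)"
    by (rule bexI[of _ e]) (use e g in \<open>auto simp: keys_def restrict_def fun_eq_iff PiE_iff extensional_def\<close>)
qed auto

text \<open>Each entry is at most the total degree \<open>m\<close>, so these exponents inject into
  a finite box.\<close>

lemma finite_invariant_exponents: "finite (invariant_exponents n a m)"
proof (rule finite_imageD)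
  show "inj_on (\<lambda>e. \<lambda>i\<in>{..<n}. Poly_Mapping.lookup e i) (invariant_exponents n a m)"
    using bij_betw_exponents[THEN bij_betw_imp_inj_on]
    by (rule inj_on_subset) (auto simp: invariant_exponents_def)
  have "Poly_Mapping.lookup e i \<le> total_degree e" for e i
    by (cases "i \<in> Poly_Mapping.keys e")
      (auto simp: total_degree_def in_keys_iff intro: member_le_sum)
  then have "(\<lambda>i\<in>{..<n}. Poly_Mapping.lookup e i) \<in> PiE {..<n} (\<lambda>_. {..m})"
    if "e \<in> invariant_exponents n a m" for e
    using that by (intro restrict_PiE_iff[THEN iffD2]) (auto simp: invariant_exponents_def)
  then have "(\<lambda>e. \<lambda>i\<in>{..<n}. Poly_Mapping.lookup e i) ` invariant_exponents n a m
      \<subseteq> PiE {..<n} (\<lambda>_. {..m})"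
    by blast
  then show "finite ((\<lambda>e. \<lambda>i\<in>{..<n}. Poly_Mapping.lookup e i) ` invariant_exponents n a m)"
    by (rule finite_subset) (auto intro: finite_PiE)
qed

lemma lookup_scale_cpoly: "Poly_Mapping.lookup (scale_cpoly c p) e = c * Poly_Mapping.lookup p e"
  by (simp add: scale_cpoly_def map.rep_eq when_def)

lemma cpoly_eq_sum_single:
  fixes p :: cpoly
  assumes "finite S" "Poly_Mapping.keys p \<subseteq> S"
  shows "p = (\<Sum>e\<in>S. scale_cpoly (Poly_Mapping.lookup p e) (Poly_Mapping.single e 1))"
proof (rule poly_mapping_eqI)
  fix e
  have "Poly_Mapping.lookup p e = (\<Sum>e'\<in>S. if e' = e then Poly_Mapping.lookup p e' else 0)"
    using assms by (auto simp: sum.delta' sum.delta in_keys_iff subset_iff)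
  also have "\<dots> = Poly_Mapping.lookup
      (\<Sum>e\<in>S. scale_cpoly (Poly_Mapping.lookup p e) (Poly_Mapping.single e 1)) e"
    by (simp add: lookup_sum lookup_scale_cpoly lookup_single when_def if_distrib cong: if_cong)
  finally show "Poly_Mapping.lookup p e = \<dots>" .
qed

text \<open>Invariance and homogeneity constrain only which monomials occur in a polynomial, so the
  invariant monomials of degree \<open>m\<close> are a basis of the graded piece.\<close>

lemma fps_nth_hilbert_series:
  "fps_nth (hilbert_series n a) m = of_nat (card (invariant_exponents n a m))"
proof -
  interpret vector_space scale_cpoly by (rule vector_space_scale_cpoly)
  define W where "W = {p \<in> invariant_cpolys n a. homogeneous_cpoly m p}"
  define M where "M = invariant_exponents n a m"
  define s :: "(nat \<Rightarrow>\<^sub>0 nat) \<Rightarrow> cpoly" where "s = (\<lambda>e. Poly_Mapping.single e 1)"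
  have M: "finite M" by (simp add: M_def finite_invariant_exponents)
  have W_iff: "p \<in> W \<longleftrightarrow> Poly_Mapping.keys p \<subseteq> M" for p
    by (auto simp: W_def M_def invariant_exponents_def invariant_cpolys_iff homogeneous_cpoly_def
        total_degree_def)
  have inj: "inj_on s M"
    by (auto simp: s_def inj_on_def dest!: arg_cong[of _ _ Poly_Mapping.keys])
  have indep: "independent (s ` M)"
  proof (rule independent_if_scalars_zero)
    fix f x assume 0: "(\<Sum>x\<in>s ` M. scale_cpoly (f x) x) = 0" and x: "x \<in> s ` M"
    obtain e where e: "e \<in> M" "x = s e" using x by auto
    have "0 = Poly_Mapping.lookup (\<Sum>x\<in>s ` M. scale_cpoly (f x) x) e" by (simp add: 0)
    also have "\<dots> = (\<Sum>e'\<in>M. f (s e') * (1 when e' = e))"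
      by (simp add: sum.reindex[OF inj] lookup_sum lookup_scale_cpoly)
         (simp add: s_def lookup_single)
    also have "\<dots> = f x"
      using M e by (simp add: when_def if_distrib cong: if_cong)
    finally show "f x = 0" by simp
  qed (use M in simp)
  have "span (s ` M) = span W"
    unfolding span_eq
  proof
    show "s ` M \<subseteq> span W"
      by (auto simp: s_def W_iff intro!: span_base)
    show "W \<subseteq> span (s ` M)"
    proof
      fix p assume "p \<in> W"
      then have "p = (\<Sum>e\<in>M. scale_cpoly (Poly_Mapping.lookup p e) (s e))"
        using cpoly_eq_sum_single[OF M] by (simp add: W_iff s_def)
      also have "\<dots> \<in> span (s ` M)"
        by (intro span_sum span_scale span_base) auto
      finally show "p \<in> span (s ` M)" .
    qed
  qed
  then have "dim W = card M"
    using dim_eq_card[OF _ indep] card_image[OF inj] by simp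
  then show ?thesis by (simp add: hilbert_series_def W_def M_def)
qed

section \<open>The Molien-Weyl integral\<close>

text \<open>For \<open>m \<noteq> 0\<close> there is the single-valued primitive
  \<open>z powi m / m\<close> on the punctured plane; for \<open>m = 0\<close> this is Cauchy's
  formula for the constant 1.\<close>

lemma has_contour_integral_powi_unit_circle:
  "((\<lambda>z. z powi (m - 1)) has_contour_integral (if m = 0 then 2 * pi * \<i> else 0)) (circlepath 0 1)"
proof (cases "m = 0")
  case True
  have "((\<lambda>z. 1 / (z - 0)) has_contour_integral 2 * pi * \<i> * 1) (circlepath 0 1)"
    using Cauchy_integral_circlepath_simple[of "\<lambda>_. 1" 0 1 0] by simp
  moreover have "(\<lambda>z::complex. z powi (m - 1)) = (\<lambda>z. 1 / (z - 0))"
    using True by (simp add: fun_eq_iff power_int_minus inverse_eq_divide)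
  ultimately show ?thesis using True by simp
next
  case False
  have "((\<lambda>z. z powi m / of_int m) has_field_derivative z powi (m - 1)) (at z within S)"
    if "z \<noteq> 0" for z :: complex and S
  proof -
    have "((\<lambda>z. z powi m / of_int m) has_field_derivative of_int m * z powi (m - 1) * 1 / of_int m)
        (at z within S)"
      using that by (intro DERIV_cdivide DERIV_power_int) auto
    then show ?thesis using False by simp
  qed
  then have "((\<lambda>z. z powi (m - 1)) has_contour_integral
      (pathfinish (circlepath 0 1) powi m / of_int m - pathstart (circlepath 0 1) powi m / of_int m))
      (circlepath 0 1)"
    by (intro contour_integral_primitive[where S = "-{0}"]) auto
  then show ?thesis using False by simp
qed

section \<open>Multiple geometric series\<close>

lemma geometric_infsum:
  fixes q :: "'a :: {real_normed_field, banach}"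
  assumes "norm q < 1"
  shows "(\<lambda>k::nat. norm (q ^ k)) summable_on UNIV" "(\<Sum>\<^sub>\<infinity>k::nat. q ^ k) = 1 / (1 - q)"
proof -
  have s: "summable (\<lambda>k. norm (q ^ k))"
    using assms by (simp add: norm_power summable_geometric)
  then show "(\<lambda>k::nat. norm (q ^ k)) summable_on UNIV"
    by (intro norm_summable_imp_summable_on) simp
  show "(\<Sum>\<^sub>\<infinity>k::nat. q ^ k) = 1 / (1 - q)"
    using norm_summable_imp_has_sum[OF s geometric_sums[OF assms]] by (rule infsumI)
qed

lemma monomial_fun_PiE:
  assumes "Poly_Mapping.keys e \<subseteq> {..<n}"
  shows "monomial_fun e q = (\<Prod>j<n. q j ^ ((\<lambda>i\<in>{..<n}. Poly_Mapping.lookup e i) j))"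
proof -
  have "(\<Prod>j\<in>Poly_Mapping.keys e. q j ^ Poly_Mapping.lookup e j) = (\<Prod>j<n. q j ^ Poly_Mapping.lookup e j)"
    by (rule prod.mono_neutral_left) (use assms in \<open>simp_all add: in_keys_iff\<close>)
  then show ?thesis by (simp add: monomial_fun_def)
qed

lemma infsum_PiE_prod_power:
  fixes q :: "'b \<Rightarrow> 'a :: {real_normed_field, banach}"
  assumes "finite A" "\<And>j. j \<in> A \<Longrightarrow> norm (q j) < 1"
  shows "(\<Sum>\<^sub>\<infinity>g\<in>PiE A (\<lambda>_. UNIV :: nat set). \<Prod>j\<in>A. q j ^ g j) = (\<Prod>j\<in>A. 1 / (1 - q j))"
proof -
  have "(\<Sum>\<^sub>\<infinity>g\<in>PiE A (\<lambda>_. UNIV :: nat set). \<Prod>j\<in>A. q j ^ g j)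
      = (\<Prod>j\<in>A. \<Sum>\<^sub>\<infinity>k. q j ^ k)"
    by (rule infsum_prod_PiE_abs[OF assms(1) geometric_infsum(1)[OF assms(2)]])
  also have "\<dots> = (\<Prod>j\<in>A. 1 / (1 - q j))"
    by (intro prod.cong refl geometric_infsum(2) assms(2))
  finally show ?thesis .
qed

text \<open>A nonzero value of \<^term>\<open>infsum\<close> certifies summability.\<close>

lemma summable_PiE_prod_power:
  fixes q :: "'b \<Rightarrow> 'a :: {real_normed_field, banach}"
  assumes "finite A" "\<And>j. j \<in> A \<Longrightarrow> norm (q j) < 1"
  shows "(\<lambda>g. norm (\<Prod>j\<in>A. q j ^ g j)) summable_on (PiE A (\<lambda>_. UNIV :: nat set))"
proof -
  have "(\<Sum>\<^sub>\<infinity>g\<in>PiE A (\<lambda>_. UNIV :: nat set). norm (\<Prod>j\<in>A. q j ^ g j))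
      = (\<Prod>j\<in>A. 1 / (1 - norm (q j)))"
    using infsum_PiE_prod_power[of A "\<lambda>j. norm (q j)"] assms
    by (simp add: prod_norm[symmetric] norm_power)
  moreover have "(\<Prod>j\<in>A. 1 / (1 - norm (q j))) \<noteq> 0"
  proof
    assume "(\<Prod>j\<in>A. 1 / (1 - norm (q j))) = 0"
    then obtain j where "j \<in> A" "norm (q j) = 1"
      using assms(1) by (auto simp: prod_zero_iff)
    then show False using assms(2)[of j] by simp
  qed
  ultimately have "(\<Sum>\<^sub>\<infinity>g\<in>PiE A (\<lambda>_. UNIV :: nat set). norm (\<Prod>j\<in>A. q j ^ g j)) \<noteq> 0"
    by (simp only: not_False_eq_True)
  \<comment> \<open>\<open>infsum\<close> is 0 by default on a family without a sum, and this value
    has just been excluded.\<close>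
  then show ?thesis by (rule contrapos_np) (rule infsum_not_exists)
qed

text \<open>The multiple geometric series, transported to exponent vectors along
  \<open>bij_betw_exponents\<close>.\<close>

lemma monomial_fun_has_sum:
  assumes "\<And>j. j < n \<Longrightarrow> norm (q j) < 1"
  shows "(\<lambda>e. norm (monomial_fun e q)) summable_on {e. Poly_Mapping.keys e \<subseteq> {..<n}}"
    and "((\<lambda>e. monomial_fun e q) has_sum (\<Prod>j<n. 1 / (1 - q j))) {e. Poly_Mapping.keys e \<subseteq> {..<n}}"
proof -
  let ?E = "{e :: nat \<Rightarrow>\<^sub>0 nat. Poly_Mapping.keys e \<subseteq> {..<n}}"
  let ?r = "\<lambda>e. \<lambda>i\<in>{..<n}. Poly_Mapping.lookup e i"
  let ?P = "PiE {..<n} (\<lambda>_. UNIV :: nat set)"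
  have abs: "(\<lambda>g. norm (\<Prod>j<n. q j ^ g j)) summable_on ?P"
    by (rule summable_PiE_prod_power) (use assms in auto)
  have "(\<lambda>e. norm (\<Prod>j<n. q j ^ ?r e j)) summable_on ?E"
    using abs summable_on_reindex_bij_betw[OF bij_betw_exponents, of "\<lambda>g. norm (\<Prod>j<n. q j ^ g j)" n]
    by blast
  then show "(\<lambda>e. norm (monomial_fun e q)) summable_on ?E"
    by (rule summable_on_cong[THEN iffD1, rotated]) (simp only: monomial_fun_PiE mem_Collect_eq)
  have "infsum (\<lambda>g. \<Prod>j<n. q j ^ g j) ?P = (\<Prod>j<n. 1 / (1 - q j))"
    by (rule infsum_PiE_prod_power) (use assms in auto)
  then have "((\<lambda>g. \<Prod>j<n. q j ^ g j) has_sum (\<Prod>j<n. 1 / (1 - q j))) ?P"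
    using has_sum_infsum[OF abs_summable_summable[OF abs]] by (simp only:)
  then have "((\<lambda>e. \<Prod>j<n. q j ^ ?r e j) has_sum (\<Prod>j<n. 1 / (1 - q j))) ?E"
    using has_sum_reindex_bij_betw[OF bij_betw_exponents, of "\<lambda>g. (\<Prod>j<n. q j ^ g j)" n]
    by blast
  then show "((\<lambda>e. monomial_fun e q) has_sum (\<Prod>j<n. 1 / (1 - q j))) ?E"
    by (rule has_sum_cong[THEN iffD1, rotated]) (simp only: monomial_fun_PiE mem_Collect_eq)
qed

text \<open>The factor \<open>1 / z\<close> turns \<open>dz / (2 \<pi> \<i>)\<close> into the
  invariant measure of the unit circle; each other factor generates the powers of one variable, with
  \<open>t\<close> recording degree and \<open>z\<close> recording weight.\<close>

definition molien_integrand :: "nat \<Rightarrow> (nat \<Rightarrow> int) \<Rightarrow> complex \<Rightarrow> complex \<Rightarrow> complex" where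
  "molien_integrand n a t z = 1 / (z * (\<Prod>j<n. 1 - t * z powi a j))"

text \<open>On the unit circle the integrand is the sum of the terms \<open>f e z\<close>, which are
  dominated by \<open>norm t ^ total_degree e\<close> independently of \<open>z\<close>. Termwise
  integration is therefore allowed, and it keeps exactly the exponents of weight 0.\<close>

lemma molien_weyl:
  assumes t: "norm t < 1"
  shows "((\<lambda>e. t ^ total_degree e * (if weight a e = 0 then 1 else 0)) has_sum
      contour_integral (circlepath 0 1) (molien_integrand n a t) / (2 * pi * \<i>))
      {e. Poly_Mapping.keys e \<subseteq> {..<n}}"
proof -
  let ?E = "{e :: nat \<Rightarrow>\<^sub>0 nat. Poly_Mapping.keys e \<subseteq> {..<n}}"
  let ?C = "circlepath 0 1 :: real \<Rightarrow> complex"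
  define f where "f = (\<lambda>e z. t ^ total_degree e * z powi (weight a e - 1))"
  \<comment> \<open>At a constant vector a monomial sees only its total degree. This yields the
    summable majorant and separates the power of \<open>t\<close> from that of
    \<open>z\<close>.\<close>
  have const: "monomial_fun e (\<lambda>_. x) = x ^ total_degree e" for e x
    by (simp add: monomial_fun_def total_degree_def power_sum)
  have unif: "uniform_limit (sphere 0 1) (\<lambda>X z. \<Sum>e\<in>X. f e z) (molien_integrand n a t)
      (finite_subsets_at_top ?E)"
  proof (rule Weierstrass_m_test_general')
    show "norm (f e z) \<le> norm t ^ total_degree e" if "z \<in> sphere 0 1" for e z
      using that by (simp add: f_def norm_mult norm_power norm_power_int)
    show "(\<lambda>e. norm t ^ total_degree e) summable_on ?E"
      using monomial_fun_has_sum(1)[of n "\<lambda>_. t"] t by (simp add: const norm_power)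
    show "((\<lambda>e. f e z) has_sum molien_integrand n a t z) ?E" if "z \<in> sphere 0 1" for z
    proof -
      have z: "norm z = 1" "z \<noteq> 0" using that by auto
      have "monomial_fun e (\<lambda>j. t * z powi a j) = z powi weight a e * t ^ total_degree e" for e
        using monomial_fun_weight_action[OF z(2), of e a "\<lambda>_. t"]
        by (simp add: weight_action_def const mult.commute)
      then have "((\<lambda>e. z powi weight a e * t ^ total_degree e) has_sum
          (\<Prod>j<n. 1 / (1 - t * z powi a j))) ?E"
        using monomial_fun_has_sum(2)[of n "\<lambda>j. t * z powi a j"] t z
        by (simp add: norm_mult norm_power_int)
      then have "((\<lambda>e. 1 / z * (z powi weight a e * t ^ total_degree e)) has_sum
          1 / z * (\<Prod>j<n. 1 / (1 - t * z powi a j))) ?E"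
        by (rule has_sum_cmult_right)
      then show ?thesis
        using z by (simp add: f_def molien_integrand_def power_int_diff prod_dividef mult.commute)
    qed
  qed
  have int: "((\<lambda>z. \<Sum>e\<in>X. f e z) has_contour_integral
      (\<Sum>e\<in>X. t ^ total_degree e * (if weight a e = 0 then 2 * pi * \<i> else 0))) ?C"
    if "finite X" for X
    unfolding f_def
    by (intro has_contour_integral_sum has_contour_integral_lmul that
        has_contour_integral_powi_unit_circle)
  have "((\<lambda>X. contour_integral ?C (\<lambda>z. \<Sum>e\<in>X. f e z)) \<longlongrightarrow>
      contour_integral ?C (molien_integrand n a t)) (finite_subsets_at_top ?E)"
    by (rule contour_integral_uniform_limit_circlepath[OF _ unif])
      (auto intro!: eventually_finite_subsets_at_top_weakI has_contour_integral_integrable[OF int])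
  then have "((\<lambda>X. \<Sum>e\<in>X. t ^ total_degree e * (if weight a e = 0 then 2 * pi * \<i> else 0)) \<longlongrightarrow>
      contour_integral ?C (molien_integrand n a t)) (finite_subsets_at_top ?E)"
    by (rule Lim_transform_eventually)
      (auto intro!: eventually_finite_subsets_at_top_weakI contour_integral_unique[OF int])
  then have "((\<lambda>e. t ^ total_degree e * (if weight a e = 0 then 2 * pi * \<i> else 0)) has_sum
      contour_integral ?C (molien_integrand n a t)) ?E"
    by (simp add: has_sum_def)
  then have "((\<lambda>e. 1 / (2 * pi * \<i>) * (t ^ total_degree e * (if weight a e = 0 then 2 * pi * \<i> else 0)))
      has_sum 1 / (2 * pi * \<i>) * contour_integral ?C (molien_integrand n a t)) ?E"
    by (rule has_sum_cmult_right)
  then show ?thesis by (simp add: if_distrib cong: if_cong)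
qed

text \<open>Groups the sum over exponents by total degree: in degree \<open>m\<close> every
  invariant exponent contributes \<open>t ^ m\<close>, and their number is the coefficient.\<close>

lemma hilbert_series_sums:
  assumes t: "norm t < 1"
  shows "(\<lambda>m. fps_nth (hilbert_series n a) m * t ^ m) sums
      (contour_integral (circlepath 0 1) (molien_integrand n a t) / (2 * pi * \<i>))"
proof -
  let ?E = "{e :: nat \<Rightarrow>\<^sub>0 nat. Poly_Mapping.keys e \<subseteq> {..<n}}"
  let ?I = "contour_integral (circlepath 0 1) (molien_integrand n a t) / (2 * pi * \<i>)"
  let ?B = "\<lambda>m. {e. Poly_Mapping.keys e \<subseteq> {..<n} \<and> total_degree e = m}"
  have "bij_betw snd (Sigma UNIV ?B) ?E"
    by (rule bij_betwI[of _ _ _ "\<lambda>e. (total_degree e, e)"]) auto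
  then have "((\<lambda>p. t ^ total_degree (snd p) * (if weight a (snd p) = 0 then 1 else 0)) has_sum ?I)
      (Sigma UNIV ?B)"
    using molien_weyl[OF t]
      has_sum_reindex_bij_betw[of snd "Sigma UNIV ?B" ?E
        "\<lambda>e. t ^ total_degree e * (if weight a e = 0 then 1 else 0)"]
    by blast
  then have "((\<lambda>m. fps_nth (hilbert_series n a) m * t ^ m) has_sum ?I) UNIV"
  proof (rule has_sum_SigmaD)
    fix m
    have "((\<lambda>e. t ^ m) has_sum (\<Sum>e\<in>invariant_exponents n a m. t ^ m)) (invariant_exponents n a m)"
      by (rule has_sum_finite[OF finite_invariant_exponents])
    also have "?this \<longleftrightarrow>
      ((\<lambda>e. t ^ total_degree e * (if weight a e = 0 then 1 else 0)) has_sum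
        (\<Sum>e\<in>invariant_exponents n a m. t ^ m)) (?B m)"
      by (rule has_sum_cong_neutral) (auto simp: invariant_exponents_def)
    finally show "((\<lambda>e. t ^ total_degree (snd (m, e)) * (if weight a (snd (m, e)) = 0 then 1 else 0))
        has_sum fps_nth (hilbert_series n a) m * t ^ m) (?B m)"
      by (simp add: fps_nth_hilbert_series)
  qed
  then show ?thesis by (rule has_sum_imp_sums)
qed

section \<open>Clusters of simple poles\<close>

text \<open>The periods of \<open>exp\<close> are the multiples of \<open>2 \<pi> \<i>\<close>. This
  is what confines each perturbed factor to a single zero near the merged pole.\<close>

lemma exp_eq_1_imp_0:
  fixes w :: complex
  assumes "exp w = 1" "norm w < 2 * pi"
  shows "w = 0"
proof -
  obtain m :: int where m: "Re w = 0" "Im w = of_int (2 * m) * pi"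
    using assms(1) by (auto simp: exp_eq_1)
  then have "\<bar>Im w\<bar> = 2 * pi * \<bar>of_int m\<bar>"
    by (simp add: abs_mult)
  then have "2 * pi * \<bar>of_int m\<bar> < 2 * pi * 1"
    using assms(2) abs_Im_le_cmod[of w] by linarith
  then have "\<bar>of_int m\<bar> < (1::real)"
    by (rule mult_left_less_imp_less) simp
  then have "m = 0" by linarith
  with m show ?thesis by (simp add: complex_eq_iff)
qed

lemma tendsto_fun_apply: "((\<lambda>c. c j) \<longlongrightarrow> b j) (nhds b)"
  for b :: "nat \<Rightarrow> real"
proof -
  have "isCont (\<lambda>c::nat \<Rightarrow> real. c j) b"
    by (rule continuous_on_interior[OF continuous_on_product_coordinates]) simp
  then show ?thesis
    by (simp only: isCont_def tendsto_at_iff_tendsto_nhds[of "\<lambda>c. c j"])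
qed

text \<open>The summand of index \<open>(i, \<zeta>)\<close> with \<open>\<omega> j\<close> standing
  for \<open>\<zeta> powi a j\<close>, so that the root of unity stays frozen while \<open>c\<close>
  varies.\<close>

definition residue_summand ::
  "nat \<Rightarrow> (nat \<Rightarrow> complex) \<Rightarrow> complex \<Rightarrow> (nat \<Rightarrow> real) \<Rightarrow> nat \<Rightarrow> complex" where
  "residue_summand n \<omega> L c i = 1 / (- of_real (c i) *
      (\<Prod>j\<in>{..<n} - {i}. 1 - \<omega> j * exp (of_real ((c i - c j) / c i) * L)))"

text \<open>The situation at one merged pole \<open>z0\<close>. The indices in \<open>I\<close> are
  those whose factors vanish at \<open>z0\<close> for \<open>c = b\<close>; the number that
  \<open>notin_I\<close> keeps away from 1 is the value at \<open>z0\<close> of what another factor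
  subtracts from 1.\<close>

locale residue_cluster =
  fixes n :: nat and b :: "nat \<Rightarrow> real" and \<omega> :: "nat \<Rightarrow> complex" and L :: complex
    and v :: real and z0 :: complex and I :: "nat set"
  assumes z0: "z0 \<noteq> 0" and v: "v \<noteq> 0" and L: "L \<noteq> 0"
    and I: "I \<subseteq> {..<n}"
    and in_I: "\<And>j. j \<in> I \<Longrightarrow> \<omega> j = 1" "\<And>j. j \<in> I \<Longrightarrow> b j = v"
    and notin_I: "\<And>j. j < n \<Longrightarrow> j \<notin> I \<Longrightarrow> \<omega> j * exp (L - b j * L / v) \<noteq> 1"
begin

text \<open>\<open>u\<close> is the branch of the logarithm (up to a constant) with \<open>u z0 = - L / v\<close>.\<close>

definition u :: "complex \<Rightarrow> complex" where
  "u z = Ln (z / z0) - L / v"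

definition H :: "nat \<Rightarrow> real \<Rightarrow> complex \<Rightarrow> complex" where
  "H j x z = 1 - \<omega> j * exp (L + x * u z)"

definition G :: "(nat \<Rightarrow> real) \<Rightarrow> complex \<Rightarrow> complex" where
  "G c z = 1 / (z * (\<Prod>j<n. H j (c j) z))"

text \<open>The solution of \<open>u z = - L / x\<close>, obtained by inverting the logarithm in
  \<open>u\<close>; it equals \<open>z0\<close> at \<open>x = v\<close>.\<close>

definition P :: "real \<Rightarrow> complex" where
  "P x = z0 * exp (L / v - L / x)"

abbreviation summand :: "(nat \<Rightarrow> real) \<Rightarrow> nat \<Rightarrow> complex" where
  "summand \<equiv> residue_summand n \<omega> L"

text \<open>An open condition on \<open>c\<close> and \<open>z\<close> that controls all zeros: the
  bound \<open>2 * pi\<close> leaves a factor in \<open>I\<close> only the zero where its exponent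
  \<open>L + c j * u z\<close> is 0, and the other factors have none.\<close>

definition good :: "(nat \<Rightarrow> real) \<Rightarrow> complex \<Rightarrow> bool" where
  "good c z \<longleftrightarrow> (\<forall>j<n. if j \<in> I then c j \<noteq> 0 \<and> norm (L + c j * u z) < 2 * pi
     else H j (c j) z \<noteq> 0)"

section \<open>Zeros of the perturbed factors near the merged pole\<close>

lemma finite_I: "finite I"
  using I finite_subset by blast

text \<open>In this ball \<open>z / z0\<close> has distance less than 1 from 1, hence lies in the
  right half-plane, away from the branch cut of \<open>Ln\<close>.\<close>

lemma ball_quotient:
  assumes "z \<in> ball z0 (norm z0)"
  shows "z \<noteq> 0" "z / z0 \<notin> \<real>\<^sub>\<le>\<^sub>0"
proof -
  show "z \<noteq> 0" using assms by (auto simp: dist_norm)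
  have "norm (1 - z / z0) = norm (z0 - z) / norm z0"
    using z0 by (metis diff_divide_distrib divide_self norm_divide)
  also have "\<dots> < 1" using assms z0 by (simp add: dist_norm)
  finally have "\<bar>Re (1 - z / z0)\<bar> < 1"
    using abs_Re_le_cmod[of "1 - z / z0"] by linarith
  then have "Re (z / z0) > 0" by simp
  then show "z / z0 \<notin> \<real>\<^sub>\<le>\<^sub>0"
    by (auto simp: complex_nonpos_Reals_iff)
qed

lemma u_z0: "u z0 = - (L / v)"
  using z0 by (simp add: u_def)

lemma has_derivative_u:
  assumes "z \<in> ball z0 (norm z0)"
  shows "(u has_field_derivative 1 / z) (at z within S)"
  unfolding u_def
  by (rule derivative_eq_intros refl | use ball_quotient[OF assms] z0 in simp)+

lemma continuous_on_u: "continuous_on (ball z0 (norm z0)) u"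
  by (metis DERIV_continuous_on has_derivative_u)

lemma has_derivative_H:
  assumes "z \<in> ball z0 (norm z0)"
  shows "(H j x has_field_derivative - (\<omega> j * (exp (L + x * u z) * (x / z)))) (at z within S)"
  unfolding H_def
  by (rule derivative_eq_intros has_derivative_u[OF assms] refl | simp)+

lemma holomorphic_H: "H j x holomorphic_on ball z0 (norm z0)"
  unfolding holomorphic_on_def field_differentiable_def using has_derivative_H by blast

lemma H_eq_0_imp:
  assumes "good c z" "z \<in> ball z0 (norm z0)" "j < n" "H j (c j) z = 0"
  shows "j \<in> I \<and> u z = - (L / c j) \<and> z = P (c j)"
proof -
  have j: "j \<in> I" "c j \<noteq> 0" "norm (L + c j * u z) < 2 * pi"
    using assms by (auto simp: good_def split: if_splits)
  have "exp (L + c j * u z) = 1"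
    using assms(4) in_I(1)[OF j(1)] by (simp add: H_def)
  then have "L + c j * u z = 0"
    using j(3) by (rule exp_eq_1_imp_0)
  then have uz: "u z = - (L / c j)"
    using j(2) by (simp add: field_simps add_eq_0_iff)
  then have "Ln (z / z0) = L / v - L / c j"
    by (simp add: u_def algebra_simps)
  then have "z / z0 = exp (L / v - L / c j)"
    using ball_quotient(1)[OF assms(2)] z0 by (metis divide_eq_0_iff exp_Ln)
  then have "z = P (c j)"
    using z0 by (simp add: P_def field_simps)
  with uz j(1) show ?thesis by simp
qed

text \<open>Each clause is open and holds at \<open>(b, z0)\<close>: for \<open>j \<in> I\<close>
  the exponent is \<open>L - v * (L / v) = 0\<close>, and for the other indices the clause is
  \<open>notin_I\<close>.\<close>

lemma eventually_good: "eventually (\<lambda>p. good (fst p) (snd p)) (nhds (b, z0))"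
proof -
  have c: "((\<lambda>p. fst p j) \<longlongrightarrow> b j) (nhds (b, z0))" for j
    by (rule filterlim_compose[OF tendsto_fun_apply])
      (use tendsto_fst[OF filterlim_ident, of "(b, z0)"] in simp)
  have "isCont u z0"
    using continuous_on_u z0 by (simp add: continuous_on_eq_continuous_at)
  then have "(u \<longlongrightarrow> u z0) (nhds z0)"
    by (simp add: isCont_def tendsto_at_iff_tendsto_nhds)
  then have "(u \<longlongrightarrow> - (L / v)) (nhds z0)"
    by (simp add: u_z0)
  moreover have "((\<lambda>p. snd p) \<longlongrightarrow> z0) (nhds (b, z0))"
    using tendsto_snd[OF filterlim_ident, of "(b, z0)"] by simp
  ultimately have u: "((\<lambda>p. u (snd p)) \<longlongrightarrow> - (L / v)) (nhds (b, z0))"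
    by (rule filterlim_compose)
  have "eventually (\<lambda>p. if j \<in> I then fst p j \<noteq> 0 \<and> norm (L + fst p j * u (snd p)) < 2 * pi
     else H j (fst p j) (snd p) \<noteq> 0) (nhds (b, z0))" if "j < n" for j
  proof (cases "j \<in> I")
    case True
    have "((\<lambda>p. norm (L + fst p j * u (snd p))) \<longlongrightarrow> norm (L + v * (- (L / v)))) (nhds (b, z0))"
      by (intro tendsto_intros c[of j, unfolded in_I(2)[OF True]] u)
    then have "((\<lambda>p. norm (L + fst p j * u (snd p))) \<longlongrightarrow> 0) (nhds (b, z0))"
      using v by simp
    then have "eventually (\<lambda>p. norm (L + fst p j * u (snd p)) < 2 * pi) (nhds (b, z0))"
      by (rule order_tendstoD) simp
    moreover have "eventually (\<lambda>p. fst p j \<noteq> 0) (nhds (b, z0))"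
      using tendsto_imp_eventually_ne[OF c[of j]] v in_I(2)[OF True] by simp
    ultimately show ?thesis
      by (rule eventually_elim2) (simp add: True)
  next
    case False
    have "((\<lambda>p. H j (fst p j) (snd p)) \<longlongrightarrow> 1 - \<omega> j * exp (L + b j * (- (L / v)))) (nhds (b, z0))"
      unfolding H_def by (intro tendsto_intros c u)
    moreover have "1 - \<omega> j * exp (L + b j * (- (L / v))) \<noteq> 0"
      using notin_I[OF that False] by simp
    ultimately have "eventually (\<lambda>p. H j (fst p j) (snd p) \<noteq> 0) (nhds (b, z0))"
      by (rule tendsto_imp_eventually_ne)
    then show ?thesis using False by simp
  qed
  then have "eventually (\<lambda>p. \<forall>j\<in>{..<n}. if j \<in> I then fst p j \<noteq> 0 \<and> norm (L + fst p j * u (snd p)) < 2 * pi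
     else H j (fst p j) (snd p) \<noteq> 0) (nhds (b, z0))"
    by (intro eventually_ball_finite) auto
  then show ?thesis by (simp only: good_def Ball_def lessThan_iff)
qed

text \<open>A neighbourhood of \<open>(b, z0)\<close> contains a product of neighbourhoods. The
  radius is doubled so that the closed disc of radius \<open>r\<close> lies inside an open ball of
  good points.\<close>

lemma good_region:
  obtains U r where "open U" "b \<in> U" "0 < r" "2 * r \<le> norm z0"
    "\<And>c z. c \<in> U \<Longrightarrow> z \<in> ball z0 (2 * r) \<Longrightarrow> good c z"
proof -
  obtain A B where A: "eventually A (nhds b)" and B: "eventually B (nhds z0)"
    and AB: "\<And>c z. A c \<Longrightarrow> B z \<Longrightarrow> good c z"
    using eventually_good unfolding nhds_prod eventually_prod_filter by auto
  obtain U where U: "open U" "b \<in> U" "\<And>c. c \<in> U \<Longrightarrow> A c"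
    using A unfolding eventually_nhds by blast
  obtain d where d: "d > 0" "\<And>z. dist z z0 < d \<Longrightarrow> B z"
    using B unfolding eventually_nhds_metric by blast
  show ?thesis
    by (rule that[of U "min d (norm z0) / 2"])
      (use U d z0 in \<open>auto intro!: AB simp: dist_commute\<close>)
qed

lemma holomorphic_G:
  assumes "\<And>z. z \<in> S \<Longrightarrow> good c z" "S \<subseteq> ball z0 (norm z0)"
  shows "G c holomorphic_on S - (\<lambda>i. P (c i)) ` I"
proof -
  have "H j (c j) z \<noteq> 0" if "z \<in> S - (\<lambda>i. P (c i)) ` I" "j < n" for j z
    using H_eq_0_imp[of c z j] that assms by blast
  moreover have "z \<noteq> 0" if "z \<in> S" for z
    using that assms(2) ball_quotient(1) by blast
  ultimately show ?thesis
    unfolding G_def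
    by (intro holomorphic_intros holomorphic_on_subset[OF holomorphic_H]) (use assms(2) in auto)
qed

text \<open>The factor of index \<open>i\<close> has a simple zero at \<open>P (c i)\<close> with
  derivative \<open>- (c i / P (c i))\<close>, and injectivity of \<open>c\<close> keeps the other
  factors nonzero there. The point \<open>P (c i)\<close> cancels against the \<open>1 / z\<close>
  of \<open>G\<close>.\<close>

lemma residue_G:
  assumes S: "open S" "S \<subseteq> ball z0 (norm z0)" "\<And>z. z \<in> S \<Longrightarrow> good c z"
    and inj: "inj_on c I" and i: "i \<in> I" "P (c i) \<in> S" "u (P (c i)) = - (L / c i)"
  shows "residue (G c) (P (c i)) = summand c i"
proof (rule residue_simple')
  let ?p = "P (c i)"
  let ?Q = "(\<lambda>j. P (c j)) ` I"
  show "open (S - (?Q - {?p}))"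
    using S(1) finite_I by (intro open_Diff finite_imp_closed) auto
  show "?p \<in> S - (?Q - {?p})" using i by auto
  have "G c holomorphic_on S - ?Q"
    using holomorphic_G S by blast
  then show "G c holomorphic_on S - (?Q - {?p}) - {?p}"
    by (rule holomorphic_on_subset) auto
  have i_n: "i < n" using i I by auto
  have p: "?p \<in> ball z0 (norm z0)" "?p \<noteq> 0"
    using i S ball_quotient(1) by blast+
  have ci: "c i \<noteq> 0"
    using S(3)[OF i(2)] i i_n unfolding good_def by metis
  \<comment> \<open>Substituting \<open>u ?p = - (L / c i)\<close> turns the exponent
    \<open>L + c j * u ?p\<close> into \<open>(c i - c j) / c i * L\<close>, the power of
    \<open>t\<close> in the summand.\<close>
  have Hp: "H j (c j) ?p = 1 - \<omega> j * exp (of_real ((c i - c j) / c i) * L)" for j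
    using ci by (simp add: H_def i(3) diff_divide_distrib algebra_simps)
  have nz: "H j (c j) ?p \<noteq> 0" if "j < n" "j \<noteq> i" for j
  proof
    assume "H j (c j) ?p = 0"
    from H_eq_0_imp[OF S(3)[OF i(2)] p(1) \<open>j < n\<close> this]
    have "j \<in> I" "L / c i = L / c j" using i(3) by auto
    then have "c i = c j" using L by (auto simp: divide_inverse)
    then show False using inj i(1) \<open>j \<in> I\<close> that by (auto dest: inj_onD)
  qed
  have "(H i (c i) has_field_derivative - (c i / ?p)) (at ?p)"
    using has_derivative_H[OF p(1), of i "c i" UNIV] in_I(1)[OF i(1)] ci by (simp add: i(3))
  moreover have "H i (c i) ?p = 0"
    using in_I(1)[OF i(1)] ci by (simp add: Hp)
  ultimately have lim_i: "((\<lambda>w. H i (c i) w / (w - ?p)) \<longlongrightarrow> - (c i / ?p)) (at ?p)"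
    by (simp add: has_field_derivative_iff)
  have lim_j: "((\<lambda>w. H j (c j) w) \<longlongrightarrow> H j (c j) ?p) (at ?p)" for j
    using has_derivative_H[OF p(1)] DERIV_isCont isCont_def by blast
  have "((\<lambda>w. 1 / (w * (\<Prod>j\<in>{..<n} - {i}. H j (c j) w) * (H i (c i) w / (w - ?p)))) \<longlongrightarrow>
      1 / (?p * (\<Prod>j\<in>{..<n} - {i}. H j (c j) ?p) * - (c i / ?p))) (at ?p)"
    using p ci nz by (intro tendsto_intros lim_i lim_j) auto
  also have "1 / (?p * (\<Prod>j\<in>{..<n} - {i}. H j (c j) ?p) * - (c i / ?p)) = summand c i"
  proof -
    have "1 / (?p * Q * - (c i / ?p)) = 1 / (- of_real (c i) * Q)" for Q
      using p ci by (simp add: field_simps)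
    then show ?thesis by (simp only: residue_summand_def Hp)
  qed
  finally show "((\<lambda>w. G c w * (w - ?p)) \<longlongrightarrow> summand c i) (at ?p)"
  proof (rule Lim_transform_eventually)
    have "1 / (w * (\<Prod>j\<in>{..<n} - {i}. H j (c j) w) * (H i (c i) w / (w - ?p))) = G c w * (w - ?p)"
      if "w \<noteq> ?p" for w
      using i_n by (simp add: G_def prod.remove[of "{..<n}" i] mult_ac)
    then show "\<forall>\<^sub>F w in at ?p. 1 / (w * (\<Prod>j\<in>{..<n} - {i}. H j (c j) w) * (H i (c i) w / (w - ?p)))
        = G c w * (w - ?p)"
      by (auto simp: eventually_at_filter)
  qed
qed

text \<open>
  At \<open>c = b\<close> all the poles \<open>P (c i)\<close> with \<open>i \<in> I\<close> merge at \<open>z0\<close>; the integral over a fixed circle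
  around them is continuous in \<open>c\<close>.
\<close>

lemma tendsto_sum_summand:
  assumes F: "F \<le> nhds b" and inj: "eventually (\<lambda>c. inj_on c I) F"
  shows "((\<lambda>c. \<Sum>i\<in>I. summand c i) \<longlongrightarrow> residue (G b) z0) F"
\<comment> \<open>Passing to the limit under the integral uses a proper filter; along
  \<open>bot\<close> every limit holds.\<close>
proof (cases "F = bot")
  case False
  obtain U r where U: "open U" "b \<in> U" and r: "0 < r" "2 * r \<le> norm z0"
    and good: "\<And>c z. c \<in> U \<Longrightarrow> z \<in> ball z0 (2 * r) \<Longrightarrow> good c z"
    using good_region by blast
  let ?C = "circlepath z0 r"
  have sub: "ball z0 (2 * r) \<subseteq> ball z0 (norm z0)" using r by auto
  \<comment> \<open>For \<open>c\<close> in \<open>U1\<close> all poles of the cluster have stayed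
    inside the circle, and \<open>u\<close> takes the intended value at each of them.\<close>
  define U1 where "U1 = {c \<in> U. \<forall>i\<in>I. P (c i) \<in> ball z0 r \<and> u (P (c i)) = - (L / c i)}"
  have holo: "G c holomorphic_on ball z0 (2 * r) - (\<lambda>i. P (c i)) ` I" if "c \<in> U" for c
    using that good sub by (intro holomorphic_G) auto
  have "eventually (\<lambda>c. c \<in> U) F"
    using F U by (meson eventually_nhds filter_leD)
  moreover have "eventually (\<lambda>c. P (c i) \<in> ball z0 r \<and> u (P (c i)) = - (L / c i)) F" if "i \<in> I" for i
  proof -
    have "((\<lambda>c. c i) \<longlongrightarrow> v) F"
      using tendsto_mono[OF F tendsto_fun_apply[of i b]] in_I(2)[OF that] by simp
    then have "((\<lambda>c. L / v - L / c i) \<longlongrightarrow> L / v - L / v) F"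
      using v by (intro tendsto_intros) auto
    then have lim: "((\<lambda>c. L / v - L / c i) \<longlongrightarrow> 0) F" by simp
    then have "((\<lambda>c. P (c i)) \<longlongrightarrow> z0 * exp 0) F"
      unfolding P_def by (intro tendsto_intros)
    then have "eventually (\<lambda>c. dist (P (c i)) z0 < r) F"
      using r by (intro tendstoD) auto
    \<comment> \<open>An imaginary part of absolute value below \<open>pi\<close> is what lets
      \<open>Ln\<close> undo \<open>exp\<close>.\<close>
    moreover have "eventually (\<lambda>c. dist (L / v - L / c i) 0 < pi) F"
      using lim by (rule tendstoD) simp
    ultimately show ?thesis
    proof eventually_elim
      case (elim c)
      then have "\<bar>Im (L / v - L / c i)\<bar> < pi"
        using abs_Im_le_cmod[of "L / v - L / c i"] by simp
      then have "Ln (exp (L / v - L / c i)) = L / v - L / c i"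
        by (intro Ln_exp) auto
      then show ?case using elim z0 by (simp add: u_def P_def dist_commute)
    qed
  qed
  ultimately have ev_U1: "eventually (\<lambda>c. c \<in> U1) F"
    unfolding U1_def using finite_I
    by (simp add: eventually_conj_iff eventually_ball_finite_distrib)
  have "b \<in> U1"
    using U r v z0 in_I(2) by (auto simp: U1_def P_def u_def)
  have cont: "continuous_on (U1 \<times> sphere z0 r) (\<lambda>(c, z). G c z)"
  proof -
    have nz: "H j (c j) z \<noteq> 0" if "c \<in> U1" "z \<in> sphere z0 r" "j < n" for c z j
    proof -
      have z: "z \<in> ball z0 (2 * r)" using that r by auto
      show ?thesis
      proof
        assume "H j (c j) z = 0"
        then have "j \<in> I \<and> z = P (c j)"
          using H_eq_0_imp[OF good[OF _ z] subsetD[OF sub z]] that unfolding U1_def by blast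
        then have "z \<in> ball z0 r" using that by (auto simp: U1_def)
        then show False using that by simp
      qed
    qed
    have z_nz: "z \<noteq> 0" if "z \<in> sphere z0 r" for z
      using that r by (auto simp: dist_norm)
    have c: "continuous_on (U1 \<times> sphere z0 r) (\<lambda>p. fst p j)" for j
      by (rule continuous_on_compose2[OF continuous_on_product_coordinates
            continuous_on_fst[OF continuous_on_id]]) simp
    have u: "continuous_on (U1 \<times> sphere z0 r) (\<lambda>p. u (snd p))"
      by (rule continuous_on_compose2[OF continuous_on_u continuous_on_snd[OF continuous_on_id]])
        (use r in auto)
    have "continuous_on (U1 \<times> sphere z0 r) (\<lambda>p. 1 / (snd p * (\<Prod>j<n. H j (fst p j) (snd p))))"
      unfolding H_def by (intro continuous_intros c u)
        (use nz z_nz in \<open>auto simp: H_def[symmetric] prod_zero_iff\<close>)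
    then show ?thesis by (simp add: G_def case_prod_unfold)
  qed
  \<comment> \<open>Compactness of the circle turns joint continuity into uniform convergence as
    \<open>c\<close> tends to \<open>b\<close>.\<close>
  have unif: "uniform_limit (sphere z0 r) G (G b) F"
  proof (rule uniform_limitI)
    fix e :: real assume "e > 0"
    then have "e / 2 > 0" by simp
    from continuous_on_prod_compactE[OF cont compact_sphere \<open>b \<in> U1\<close> this]
    obtain X where X: "b \<in> X" "open X"
      "\<forall>c\<in>X \<inter> U1. \<forall>z\<in>sphere z0 r. dist (G c z) (G b z) \<le> e / 2"
      unfolding prod.case by metis
    have "eventually (\<lambda>c. c \<in> X) F"
      using F X by (meson eventually_nhds filter_leD)
    with ev_U1 show "eventually (\<lambda>c. \<forall>z\<in>sphere z0 r. dist (G c z) (G b z) < e) F"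
    proof eventually_elim
      case (elim c)
      show ?case
      proof
        fix z assume "z \<in> sphere z0 r"
        then have "dist (G c z) (G b z) \<le> e / 2" using X(3) elim by blast
        then show "dist (G c z) (G b z) < e" using \<open>e > 0\<close> by linarith
      qed
    qed
  qed
  have integrable: "G c contour_integrable_on ?C" if "c \<in> U1" for c
  proof (rule contour_integrable_continuous_circlepath)
    have "continuous_on (sphere z0 r) (\<lambda>z. G c z)"
      using continuous_on_compose2[OF cont continuous_on_Pair[OF continuous_on_const continuous_on_id],
          of c "sphere z0 r"] that
      by auto
    then show "continuous_on (path_image ?C) (G c)" using r by simp
  qed
  have int: "contour_integral ?C (G c) = 2 * pi * \<i> * (\<Sum>i\<in>I. summand c i)"
    if c: "c \<in> U1" "inj_on c I" for c
  proof -
    let ?Q = "(\<lambda>i. P (c i)) ` I"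
    have Q: "P (c i) \<in> ball z0 r" "u (P (c i)) = - (L / c i)" if "i \<in> I" for i
      using c(1) that by (auto simp: U1_def)
    \<comment> \<open>The values of \<open>u\<close> at the poles recover the \<open>c i\<close>, so
      distinct indices give distinct poles and the sum over poles is a sum over
      \<open>I\<close>.\<close>
    have inj': "inj_on (\<lambda>i. P (c i)) I"
    proof (rule inj_onI)
      fix i j assume ij: "i \<in> I" "j \<in> I" "P (c i) = P (c j)"
      then have "L / c i = L / c j" using Q(2) by (metis neg_equal_iff_equal)
      then have "c i = c j" using L by (auto simp: divide_inverse)
      then show "i = j" using c(2) ij by (auto dest: inj_onD)
    qed
    have "contour_integral ?C (G c) = 2 * pi * \<i> * (\<Sum>p\<in>?Q. winding_number ?C p * residue (G c) p)"
    proof (rule Residue_theorem)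
      show "G c holomorphic_on ball z0 (2 * r) - ?Q"
        using holo c by (auto simp: U1_def)
      show "path_image ?C \<subseteq> ball z0 (2 * r) - ?Q"
        using Q(1) r by (fastforce simp: sphere_def)
      show "\<forall>z. z \<notin> ball z0 (2 * r) \<longrightarrow> winding_number ?C z = 0"
        using r by (auto intro!: winding_number_zero_outside[where s = "cball z0 r"])
    qed (use finite_I in auto)
    also have "(\<Sum>p\<in>?Q. winding_number ?C p * residue (G c) p)
      = (\<Sum>i\<in>I. winding_number ?C (P (c i)) * residue (G c) (P (c i)))"
      by (simp add: sum.reindex[OF inj'])
    also have "\<dots> = (\<Sum>i\<in>I. summand c i)"
    proof (intro sum.cong refl)
      fix i assume i: "i \<in> I"
      have "winding_number ?C (P (c i)) = 1"
        using Q(1)[OF i] by (intro winding_number_circlepath) (simp add: dist_norm norm_minus_commute)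
      moreover have "residue (G c) (P (c i)) = summand c i"
        by (rule residue_G[of "ball z0 (2 * r)"])
          (use sub c good Q[OF i] r i in \<open>auto simp: U1_def\<close>)
      ultimately show "winding_number ?C (P (c i)) * residue (G c) (P (c i)) = summand c i" by simp
    qed
    finally show ?thesis .
  qed
  \<comment> \<open>At \<open>b\<close> every pole of the cluster sits at \<open>z0\<close>, so only
    this one singularity, of whatever order, can remain inside the circle.\<close>
  have Gb: "contour_integral ?C (G b) = 2 * pi * \<i> * residue (G b) z0"
  proof (rule contour_integral_unique[OF base_residue[of "ball z0 (2 * r)"]])
    have "P (b i) = z0" if "i \<in> I" for i
      using in_I(2)[OF that] v by (simp add: P_def)
    then show "G b holomorphic_on ball z0 (2 * r) - {z0}"
      using holomorphic_on_subset[OF holo[OF U(2)]] by blast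
  qed (use r in auto)
  have "((\<lambda>c. contour_integral ?C (G c)) \<longlongrightarrow> contour_integral ?C (G b)) F"
    by (rule contour_integral_uniform_limit_circlepath(2)[OF _ unif False r(1)])
      (rule eventually_mono[OF ev_U1 integrable])
  moreover have "eventually (\<lambda>c. contour_integral ?C (G c) = 2 * pi * \<i> * (\<Sum>i\<in>I. summand c i)) F"
    using ev_U1 inj by eventually_elim (rule int)
  ultimately have "((\<lambda>c. 2 * pi * \<i> * (\<Sum>i\<in>I. summand c i)) \<longlongrightarrow> 2 * pi * \<i> * residue (G b) z0) F"
    unfolding Gb by (rule Lim_transform_eventually)
  then show ?thesis
    by (rule tendsto_mult_left_iff[THEN iffD1, rotated]) simp
qed auto

end

section \<open>Poles of the Molien integrand\<close>

text \<open>\<open>Euclidean_space n\<close> is a subspace of the product topology on functions, so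
  every open neighbourhood restricts to a relatively open one. This makes limits along
  \<open>nhds\<close> available for the filter of the theorem.\<close>

lemma generic_near_le_nhds: "generic_near n k a \<le> nhds (real_vec n a)"
  unfolding le_nhds
proof safe
  fix S assume S: "open S" "real_vec n a \<in> S"
  have "openin (Euclidean_space n) ({x. \<forall>i\<ge>n. x i = 0} \<inter> S)"
    unfolding Euclidean_space_def
    by (rule openin_subtopology_Int2) (simp add: euclidean_product_topology S(1))
  moreover have "real_vec n a \<in> {x. \<forall>i\<ge>n. x i = 0} \<inter> S"
    using S by (auto simp: real_vec_def)
  ultimately show "eventually (\<lambda>c. c \<in> S) (generic_near n k a)"
    unfolding generic_near_def eventually_atin_within by blast
qed

lemma eventually_generic_near_inj_on: "eventually (\<lambda>c. inj_on c {..<k}) (generic_near n k a)"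
proof (cases "real_vec n a \<in> topspace (Euclidean_space n)")
  case True
  then show ?thesis
    unfolding generic_near_def eventually_atin_within
    by (intro disjI2 exI[of _ "topspace (Euclidean_space n)"]) (auto simp: inj_on_def)
next
  case False
  then show ?thesis by (simp add: generic_near_def eventually_atin_within)
qed

section \<open>Location of the poles in the unit disc\<close>

definition unity_roots :: "int \<Rightarrow> complex set" where
  "unity_roots v = {\<zeta>. \<zeta> powi (- v) = 1}"

definition molien_pole :: "complex \<Rightarrow> int \<Rightarrow> complex \<Rightarrow> complex" where
  "molien_pole L v \<zeta> = \<zeta> * exp (- (L / of_int v))"

lemma unity_roots_neg:
  assumes "v < 0"
  shows "unity_roots v = {\<zeta>. \<zeta> ^ nat (- v) = 1}" "finite (unity_roots v)"
proof -
  show "unity_roots v = {\<zeta>. \<zeta> ^ nat (- v) = 1}"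
    using assms by (simp add: unity_roots_def power_int_def)
  then show "finite (unity_roots v)"
    using finite_roots_unity[of "nat (- v)"] assms by (simp add: Suc_le_eq)
qed

lemma unity_rootsD:
  assumes "v < 0" "\<zeta> \<in> unity_roots v"
  shows "norm \<zeta> = 1" "\<zeta> \<noteq> 0" "\<zeta> powi v = 1"
proof -
  have "\<zeta> ^ nat (- v) = 1" using assms unity_roots_neg by blast
  then show n: "norm \<zeta> = 1"
    using assms(1) power_eq_1_iff by fastforce
  then show "\<zeta> \<noteq> 0" by auto
  show "\<zeta> powi v = 1"
    using assms(2) by (simp add: unity_roots_def power_int_minus)
qed

lemma norm_molien_pole:
  assumes "v < 0" "\<zeta> \<in> unity_roots v"
  shows "norm (molien_pole L v \<zeta>) = exp (- (Re L / of_int v))"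
  using unity_rootsD[OF assms] Re_divide_of_real[of L "of_int v"]
  by (simp add: molien_pole_def norm_mult)

text \<open>The modulus \<open>exp (- (Re L / v))\<close> determines \<open>v\<close> because
  \<open>Re L \<noteq> 0\<close>, and then \<open>\<zeta>\<close> is determined too. Poles of
  different weights thus never collide.\<close>

lemma inj_on_molien_pole:
  assumes "Re L < 0" "\<And>v. v \<in> V \<Longrightarrow> v < 0"
  shows "inj_on (\<lambda>(v, \<zeta>). molien_pole L v \<zeta>) (SIGMA v:V. unity_roots v)"
proof (rule inj_onI, clarify)
  fix v \<zeta> v' \<zeta>'
  assume *: "v \<in> V" "\<zeta> \<in> unity_roots v" "v' \<in> V" "\<zeta>' \<in> unity_roots v'"
    "molien_pole L v \<zeta> = molien_pole L v' \<zeta>'"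
  then have "exp (- (Re L / of_int v)) = exp (- (Re L / of_int v'))"
    using norm_molien_pole assms(2) by metis
  then have "Re L / of_int v = Re L / of_int v'" by simp
  then have v: "v = v'"
    using assms(1) by (auto simp: divide_inverse)
  then show "v = v' \<and> \<zeta> = \<zeta>'"
    using *(5) by (simp add: molien_pole_def)
qed

lemma power_eq_exp_iff_molien_pole:
  assumes "v < 0"
  shows "z ^ nat (- v) = exp L \<longleftrightarrow> (\<exists>\<zeta>\<in>unity_roots v. z = molien_pole L v \<zeta>)"
proof -
  have ex: "exp (L / of_int v) ^ nat (- v) = exp (- L)"
    using assms by (simp flip: exp_of_nat_mult)
  have pole: "z = molien_pole L v (z * exp (L / of_int v))"
    by (simp add: molien_pole_def exp_minus)
  have "z ^ nat (- v) = exp L \<longleftrightarrow> z * exp (L / of_int v) \<in> unity_roots v"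
  proof -
    have "(z * exp (L / of_int v)) ^ nat (- v) = z ^ nat (- v) / exp L"
      by (simp only: power_mult_distrib ex) (simp add: exp_minus divide_inverse)
    then show ?thesis by (simp add: unity_roots_neg(1)[OF assms])
  qed
  also have "\<dots> \<longleftrightarrow> (\<exists>\<zeta>\<in>unity_roots v. z = molien_pole L v \<zeta>)"
  proof
    assume "\<exists>\<zeta>\<in>unity_roots v. z = molien_pole L v \<zeta>"
    then show "z * exp (L / of_int v) \<in> unity_roots v"
      by (auto simp: molien_pole_def mult.assoc simp flip: exp_add)
  qed (use pole in blast)
  finally show ?thesis .
qed

text \<open>The residue theorem on a disc slightly larger than the unit disc. Factors of positive
  weight vanish only outside it, those of negative weight vanish at the points
  \<open>molien_pole\<close>, and the singularity at 0 is removable because some weight is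
  negative.\<close>

lemma sum_residues_molien:
  assumes k: "0 < k" "k < n"
    and neg: "\<And>i. i < k \<Longrightarrow> a i < 0"
    and pos: "\<And>i. k \<le> i \<Longrightarrow> i < n \<Longrightarrow> a i > 0"
    and t: "norm t < 1" and L: "exp L = t"
  shows "contour_integral (circlepath 0 1) (molien_integrand n a t) =
    2 * pi * \<i> * (\<Sum>(v, \<zeta>)\<in>(SIGMA v:a ` {..<k}. unity_roots v).
      residue (molien_integrand n a t) (molien_pole L v \<zeta>))"
proof -
  let ?V = "SIGMA v:a ` {..<k}. unity_roots v"
  define Q where "Q = (\<lambda>(v, \<zeta>). molien_pole L v \<zeta>) ` ?V"
  have ReL: "Re L < 0" using t L[symmetric] by simp
  have neg': "v < 0" if "v \<in> a ` {..<k}" for v using that neg by auto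
  have inj: "inj_on (\<lambda>(v, \<zeta>). molien_pole L v \<zeta>) ?V"
    using inj_on_molien_pole[OF ReL neg'] by blast
  have finQ: "finite Q"
    unfolding Q_def using neg' unity_roots_neg by (intro finite_imageI finite_SigmaI) auto
  have normQ: "p \<noteq> 0" "norm p < 1" if p: "p \<in> Q" for p
  proof -
    obtain i \<zeta> where i: "i < k" and v: "\<zeta> \<in> unity_roots (a i)" "p = molien_pole L (a i) \<zeta>"
      using p by (auto simp: Q_def)
    note v = neg[OF i] v
    show "norm p < 1"
      using v ReL by (simp add: norm_molien_pole divide_neg_neg)
    show "p \<noteq> 0" using v unity_rootsD by (auto simp: molien_pole_def)
  qed
  define m where "m j = nat \<bar>a j\<bar>" for j
  \<comment> \<open>the factors of the integrand, cleared of negative powers so that they extend to \<open>0\<close>\<close>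
  define \<phi> where "\<phi> j z = (if j < k then z ^ m j / (z ^ m j - t) else 1 / (1 - t * z ^ m j))" for j z
  \<comment> \<open>The factor of index 0 has negative weight and absorbs \<open>1 / z\<close>,
    which lowers its power to \<open>m 0 - 1\<close>; the subtraction is genuine since
    \<open>m 0 > 0\<close>.\<close>
  define N where "N z = z ^ (m 0 - 1) / (z ^ m 0 - t) * (\<Prod>j\<in>{..<n} - {0}. \<phi> j z)" for z
  have \<phi>: "\<phi> j z = 1 / (1 - t * z powi a j)" if "z \<noteq> 0" "j < n" for j z
  proof (cases "j < k")
    case True
    then have "z powi a j = 1 / z ^ m j"
      using neg[of j] by (simp add: m_def power_int_def inverse_eq_divide power_one_over)
    \<comment> \<open>For \<open>x = t\<close> both sides are 0 by the convention on division by
      zero, so the identity holds at the poles as well.\<close>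
    moreover have "x / (x - t) = 1 / (1 - t * (1 / x))" if "x \<noteq> 0" for x
      using that by (cases "x = t") (auto simp: field_simps)
    ultimately show ?thesis using True that by (simp add: \<phi>_def)
  next
    case False
    then have "z powi a j = z ^ m j"
      using pos[of j] that by (simp add: m_def power_int_def)
    then show ?thesis using False by (simp add: \<phi>_def)
  qed
  have m0: "m 0 > 0" using neg[of 0] k by (simp add: m_def)
  have N: "N z = molien_integrand n a t z" if "z \<noteq> 0" for z
  proof -
    have "z ^ (m 0 - 1) / (z ^ m 0 - t) = 1 / z * \<phi> 0 z"
      using m0 that k by (cases "m 0") (auto simp: \<phi>_def)
    then have "N z = 1 / z * (\<phi> 0 z * (\<Prod>j\<in>{..<n} - {0}. \<phi> j z))"
      by (simp add: N_def)
    also have "\<phi> 0 z * (\<Prod>j\<in>{..<n} - {0}. \<phi> j z) = (\<Prod>j<n. \<phi> j z)"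
      using k by (subst prod.remove[of "{..<n}" 0]) auto
    also have "\<dots> = (\<Prod>j<n. 1 / (1 - t * z powi a j))"
      using that by (intro prod.cong) (auto simp: \<phi>)
    finally show ?thesis by (simp add: molien_integrand_def prod_dividef)
  qed
  \<comment> \<open>The strict inequality holds at \<open>R = 1\<close> and involves finitely many
    indices, so it survives for some \<open>R > 1\<close>.\<close>
  have "eventually (\<lambda>R. \<forall>j\<in>{..<n}. norm t * R ^ m j < 1) (nhds 1)"
  proof (intro eventually_ball_finite ballI)
    fix j
    have "((\<lambda>R::real. norm t * R ^ m j) \<longlongrightarrow> norm t * 1 ^ m j) (nhds 1)"
      by (intro tendsto_intros filterlim_ident)
    then show "eventually (\<lambda>R. norm t * R ^ m j < 1) (nhds 1)"
      by (rule order_tendstoD) (use t in simp)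
  qed simp
  then obtain d where d: "d > 0" "\<And>R j. \<lbrakk>dist R 1 < d; j < n\<rbrakk> \<Longrightarrow> norm t * R ^ m j < 1"
    unfolding eventually_nhds_metric by fastforce
  define R where "R = 1 + d / 2"
  have R: "R > 1" "\<And>j. j < n \<Longrightarrow> norm t * R ^ m j < 1"
    using d by (auto simp: R_def dist_norm)
  have pole_Q: "z ^ m j - t \<noteq> 0" if "z \<notin> Q" and j: "j < k" for j z
  proof
    assume "z ^ m j - t = 0"
    then have "z ^ nat (- a j) = exp L"
      using neg[OF j] L by (simp add: m_def)
    then obtain \<zeta> where "\<zeta> \<in> unity_roots (a j)" "z = molien_pole L (a j) \<zeta>"
      using power_eq_exp_iff_molien_pole[OF neg[OF j]] by blast
    then show False using that by (force simp: Q_def)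
  qed
  have nz: "1 - t * z ^ m j \<noteq> 0" if "norm z < R" "j < n" for j z
  proof
    assume "1 - t * z ^ m j = 0"
    then have "1 = norm (t * z ^ m j)" by simp
    also have "\<dots> \<le> norm t * R ^ m j"
      using that by (auto simp: norm_mult norm_power intro!: mult_left_mono power_mono)
    finally show False using R(2)[OF that(2)] by simp
  qed
  have holo: "N holomorphic_on ball 0 R - Q"
  proof -
    have "\<phi> j holomorphic_on ball 0 R - Q" if "j < n" for j
    proof (cases "j < k")
      case True
      then have "\<phi> j = (\<lambda>z. z ^ m j / (z ^ m j - t))" by (simp add: \<phi>_def fun_eq_iff)
      then show ?thesis using pole_Q True by (auto intro!: holomorphic_intros)
    next
      case False
      then have "\<phi> j = (\<lambda>z. 1 / (1 - t * z ^ m j))" by (simp add: \<phi>_def fun_eq_iff)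
      then show ?thesis using nz that by (auto intro!: holomorphic_intros)
    qed
    then show ?thesis
      unfolding N_def using pole_Q k by (intro holomorphic_intros) auto
  qed
  have "contour_integral (circlepath 0 1) (molien_integrand n a t) = contour_integral (circlepath 0 1) N"
    by (rule contour_integral_eq, rule N[symmetric]) auto
  also have "\<dots> = 2 * pi * \<i> * (\<Sum>p\<in>Q. winding_number (circlepath 0 1) p * residue N p)"
  proof (rule Residue_theorem[where S = "ball 0 R"])
    show "path_image (circlepath 0 1) \<subseteq> ball 0 R - Q"
      using R normQ by fastforce
    show "\<forall>z. z \<notin> ball 0 R \<longrightarrow> winding_number (circlepath 0 1) z = 0"
      using R by (auto intro!: winding_number_zero_outside[where s = "cball 0 1"])
  qed (use holo finQ in auto)
  also have "(\<Sum>p\<in>Q. winding_number (circlepath 0 1) p * residue N p)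
      = (\<Sum>p\<in>Q. residue (molien_integrand n a t) p)"
  proof (intro sum.cong refl)
    fix p assume p: "p \<in> Q"
    have "eventually (\<lambda>z. z \<noteq> 0) (at p)"
      using t1_space_nhds[OF normQ(1)[OF p]] eventually_nhds_conv_at by blast
    then have "residue N p = residue (molien_integrand n a t) p"
      by (intro residue_cong refl) (auto elim!: eventually_mono simp: N)
    then show "winding_number (circlepath 0 1) p * residue N p = residue (molien_integrand n a t) p"
      using normQ(2)[OF p] by (simp add: winding_number_circlepath)
  qed
  also have "\<dots> = (\<Sum>(v, \<zeta>)\<in>?V. residue (molien_integrand n a t) (molien_pole L v \<zeta>))"
    unfolding Q_def by (subst sum.reindex[OF inj]) (auto simp: case_prod_unfold)
  finally show ?thesis .
qed

text \<open>Regroups the index pairs \<open>(i, \<zeta>)\<close> by the pole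
  \<open>molien_pole L v \<zeta>\<close>, \<open>v = a i\<close>, at which their perturbed poles
  merge.\<close>

lemma perturbed_residue_sum_cluster:
  assumes neg: "\<And>i. i < k \<Longrightarrow> a i < 0"
  shows "perturbed_residue_sum n k a L c =
    (\<Sum>(v, \<zeta>)\<in>(SIGMA v:a ` {..<k}. unity_roots v).
      \<Sum>i\<in>{i\<in>{..<k}. a i = v}. residue_summand n (\<lambda>j. \<zeta> powi a j) L c i)"
proof -
  have "perturbed_residue_sum n k a L c =
      (\<Sum>i<k. \<Sum>\<zeta>\<in>unity_roots (a i). residue_summand n (\<lambda>j. \<zeta> powi a j) L c i)"
    by (simp add: perturbed_residue_sum_def unity_roots_def residue_summand_def)
  also have "\<dots> = (\<Sum>v\<in>a ` {..<k}. \<Sum>i\<in>{i\<in>{..<k}. a i = v}. \<Sum>\<zeta>\<in>unity_roots (a i).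
      residue_summand n (\<lambda>j. \<zeta> powi a j) L c i)"
    by (rule sum.image_gen) simp
  also have "\<dots> = (\<Sum>v\<in>a ` {..<k}. \<Sum>\<zeta>\<in>unity_roots v. \<Sum>i\<in>{i\<in>{..<k}. a i = v}.
      residue_summand n (\<lambda>j. \<zeta> powi a j) L c i)"
    by (intro sum.cong refl, subst sum.swap) (auto intro!: sum.cong)
  also have "\<dots> = (\<Sum>(v, \<zeta>)\<in>(SIGMA v:a ` {..<k}. unity_roots v).
      \<Sum>i\<in>{i\<in>{..<k}. a i = v}. residue_summand n (\<lambda>j. \<zeta> powi a j) L c i)"
    using neg unity_roots_neg by (intro sum.Sigma) auto
  finally show ?thesis .
qed

lemma tendsto_cluster_sum:
  assumes neg: "\<And>i. i < k \<Longrightarrow> a i < 0"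
    and pos: "\<And>i. k \<le> i \<Longrightarrow> i < n \<Longrightarrow> a i > 0"
    and kn: "k < n" and ReL: "Re L < 0" 
    and v: "v \<in> a ` {..<k}" and \<zeta>: "\<zeta> \<in> unity_roots v"
  shows "((\<lambda>c. \<Sum>i\<in>{i\<in>{..<k}. a i = v}. residue_summand n (\<lambda>j. \<zeta> powi a j) L c i) \<longlongrightarrow>
    residue (molien_integrand n a (exp L)) (molien_pole L v \<zeta>)) (generic_near n k a)"
proof -
  let ?z0 = "molien_pole L v \<zeta>"
  let ?I = "{i\<in>{..<k}. a i = v}"
  have v0: "v < 0" using v neg by auto
  note \<zeta>' = unity_rootsD[OF v0 \<zeta>]
  interpret residue_cluster n "real_vec n a" "\<lambda>j. \<zeta> powi a j" L "of_int v" ?z0 ?I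
  proof
    show "?z0 \<noteq> 0" using \<zeta>' by (simp add: molien_pole_def)
    show "real_of_int v \<noteq> 0" using v0 by simp
    show "L \<noteq> 0" using ReL by auto
    show "?I \<subseteq> {..<n}" using kn by auto
    show "\<zeta> powi a j = 1" if "j \<in> ?I" for j using that \<zeta>' by simp
    show "real_vec n a j = real_of_int v" if "j \<in> ?I" for j
      using that kn by (simp add: real_vec_def)
    show "\<zeta> powi a j * exp (L - complex_of_real (real_vec n a j) * L / complex_of_real (real_of_int v)) \<noteq> 1"
      if j: "j < n" "j \<notin> ?I" for j
    proof
      let ?w = "L - complex_of_real (real_vec n a j) * L / complex_of_real (real_of_int v)"
      assume "\<zeta> powi a j * exp ?w = 1"
      \<comment> \<open>Taking norms removes \<open>\<zeta>\<close>, and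
        \<open>Re L \<noteq> 0\<close> then forces \<open>a j = v\<close>. For \<open>j < k\<close>
        this contradicts \<open>j \<notin> ?I\<close>, for the other indices the sign of
        \<open>a j\<close>.\<close>
      then have "norm (\<zeta> powi a j * exp ?w) = 1" by simp
      then have "Re ?w = 0" using \<zeta>' by (simp add: norm_mult norm_power_int)
      moreover have "Re ?w = Re L * (1 - of_int (a j) / of_int v)"
        using j by (simp add: real_vec_def algebra_simps)
      ultimately have "of_int (a j) = (of_int v :: real)"
        using ReL v0 by (simp add: field_simps)
      then show False using j pos[of j] v0 by (cases "j < k") auto
    qed
  qed
  have "eventually (\<lambda>c. inj_on c ?I) (generic_near n k a)"
    by (rule eventually_mono[OF eventually_generic_near_inj_on]) (erule inj_on_subset, auto)
  from tendsto_sum_summand[OF generic_near_le_nhds this]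
  have "((\<lambda>c. \<Sum>i\<in>?I. summand c i) \<longlongrightarrow> residue (G (real_vec n a)) ?z0) (generic_near n k a)" .
  also have "residue (G (real_vec n a)) ?z0 = residue (molien_integrand n a (exp L)) ?z0"
  proof (rule residue_cong[OF _ refl])
    have "eventually (\<lambda>z. z \<in> ball ?z0 (norm ?z0)) (at ?z0)"
      using z0 by (intro eventually_at_in_open') auto
    then show "eventually (\<lambda>z. G (real_vec n a) z = molien_integrand n a (exp L) z) (at ?z0)"
    proof eventually_elim
      case (elim z)
      have z: "z \<noteq> 0" using ball_quotient(1)[OF elim] .
      \<comment> \<open>At integer exponents the branch disappears:
        \<open>\<zeta> powi a j * exp (a j * u z)\<close> is \<open>z powi a j\<close>, so near the
        pole the unperturbed \<open>G\<close> is the Molien integrand.\<close>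
      have exp_u: "exp (u z) = z / \<zeta>"
        unfolding u_def using z z0 \<zeta>' by (simp add: exp_diff molien_pole_def exp_minus field_simps)
      have "H j (real_vec n a j) z = 1 - exp L * z powi a j" if "j < n" for j
      proof -
        have "exp (of_int (a j) * u z) = z powi a j / \<zeta> powi a j"
          by (simp add: exp_power_int[symmetric] exp_u power_int_divide_distrib)
        then show ?thesis
          using that \<zeta>' by (simp add: H_def real_vec_def exp_add)
      qed
      then show ?case by (simp add: G_def molien_integrand_def)
    qed
  qed
  finally show ?thesis .
qed

theorem theorem3p3:
  fixes n k :: nat and a :: "nat \<Rightarrow> int" and t L :: complex
  assumes "0 < k" "k < n"
    and "\<And>i. i < k \<Longrightarrow> a i < 0"
    and "\<And>i. k \<le> i \<Longrightarrow> i < n \<Longrightarrow> a i > 0"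
    and "0 < norm t" "norm t < 1"
    and "exp L = t"
  shows "summable (\<lambda>m. fps_nth (hilbert_series n a) m * t ^ m) \<and>
    (perturbed_residue_sum n k a L \<longlongrightarrow> eval_fps (hilbert_series n a) t) (generic_near n k a)"
proof
  have sums: "(\<lambda>m. fps_nth (hilbert_series n a) m * t ^ m) sums
      (contour_integral (circlepath 0 1) (molien_integrand n a t) / (2 * pi * \<i>))"
    by (rule hilbert_series_sums) fact
  then show "summable (\<lambda>m. fps_nth (hilbert_series n a) m * t ^ m)"
    by (rule sums_summable)
  have "Re L < 0" using assms(6) assms(7)[symmetric] by simp
  have "eval_fps (hilbert_series n a) t =
      (\<Sum>(v, \<zeta>)\<in>(SIGMA v:a ` {..<k}. unity_roots v).
        residue (molien_integrand n a t) (molien_pole L v \<zeta>))"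
    using sums_unique[OF sums] sum_residues_molien[OF assms(1-4,6,7)] by (simp add: eval_fps_def)
  \<comment> \<open>Both sides are now sums over the same finite set of poles, so the limit is taken
    one pole at a time.\<close>
  moreover have "((\<lambda>c. \<Sum>(v, \<zeta>)\<in>(SIGMA v:a ` {..<k}. unity_roots v).
      \<Sum>i\<in>{i\<in>{..<k}. a i = v}. residue_summand n (\<lambda>j. \<zeta> powi a j) L c i) \<longlongrightarrow>
      (\<Sum>(v, \<zeta>)\<in>(SIGMA v:a ` {..<k}. unity_roots v).
        residue (molien_integrand n a t) (molien_pole L v \<zeta>))) (generic_near n k a)"
    unfolding case_prod_unfold
  proof (rule tendsto_sum)
    fix p assume "p \<in> (SIGMA v:a ` {..<k}. unity_roots v)"
    then show "((\<lambda>c. \<Sum>i\<in>{i\<in>{..<k}. a i = fst p}.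
        residue_summand n (\<lambda>j. snd p powi a j) L c i) \<longlongrightarrow>
        residue (molien_integrand n a t) (molien_pole L (fst p) (snd p))) (generic_near n k a)"
      using tendsto_cluster_sum[OF assms(3,4,2) \<open>Re L < 0\<close>] assms(7) by auto
  qed
  moreover have "perturbed_residue_sum n k a L = (\<lambda>c. \<Sum>(v, \<zeta>)\<in>(SIGMA v:a ` {..<k}. unity_roots v).
      \<Sum>i\<in>{i\<in>{..<k}. a i = v}. residue_summand n (\<lambda>j. \<zeta> powi a j) L c i)"
    by (intro ext perturbed_residue_sum_cluster assms(3))
  ultimately show "(perturbed_residue_sum n k a L \<longlongrightarrow> eval_fps (hilbert_series n a) t) (generic_near n k a)"
    by (simp only:)
qed

end
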